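(* Let $\mathcal{Y}\subseteq\{0,1\}^L$ be contained in a sphere, i.e. for some $r>0$, $\|\bm{y}\|=r$ for all $\bm{y}\in\mathcal{Y}$. Then: (1) If there are no high order interactions, i.e. the SparseMAP regularizer is $\Omega(\bm{y})=\frac12\|\bm{y}\|^2+I_{\mathrm{conv}(\mathcal{Y})}(\bm{y})$, then the SparseMAP loss $L_\Omega$ has a structured margin $m=1$. (2) If there are high order interactions, i.e. vectors are split as $\bm{y}=[\bm{y}_V;\bm{y}_F]$ and the SparseMAP regularizer is $\Omega(\bm{y})=\frac12\|\bm{y}_V\|^2+I_{\mathrm{conv}(\mathcal{Y})}(\bm{y})$, and, for some $r_V$ and $r_F$ with $r_V^2+r_F^2=r^2$, we have $\|\bm{y}_V\|=r_V$ and $\|\bm{y}_F\|=r_F$ for any $\bm{y}=[\bm{y}_V;\bm{y}_F]\in\mathcal{Y}$, then the SparseMAP loss $L_\Omega$ has a structured margin $m\le1$.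
   Context: $\|\cdot\|$ is the Euclidean norm, $\mathrm{conv}(\mathcal{Y})$ is the convex hull of $\mathcal{Y}$, and $I_{\mathcal{C}}$ is the indicator function of a convex set $\mathcal{C}$ ($0$ on $\mathcal{C}$, $+\infty$ outside). The set $\mathcal{Y}$ represents a set of valid structures encoded as bit vectors. In the case with high order interactions the coordinates are partitioned into a block $V$ (configurations of variable nodes of a factor graph) and a block $F$ (configurations of factor nodes), and $\bm{y}=[\bm{y}_V;\bm{y}_F]$ is the corresponding splitting; only the $V$ block is regularized. For a convex $\Omega:\mathbb{R}^L\to\mathbb{R}\cup\{+\infty\}$ with domain $\mathrm{conv}(\mathcal{Y})$, the Fenchel-Young loss is $L_\Omega(\bm{\theta};\bm{y})=\Omega(\bm{y})+\Omega^*(\bm{\theta})-\bm{\theta}^\top\bm{y}$ with $\Omega^*(\bm{\theta})=\sup_{\bm{y}}\bm{\theta}^\top\bm{y}-\Omega(\bm{y})$, for $\bm{\theta}\in\mathbb{R}^L$. With $\Omega$ the SparseMAP regularizer, it is called the SparseMAP loss. Structured margin: a loss $L(\bm{\theta};\bm{y})$ has a structured margin if there is $0\le m<\infty$ such that for all $\bm{y}\in\mathcal{Y}$ (and all $\bm{\theta}\in\mathbb{R}^L$), $$\bm{\theta}^\top\bm{y}\ge\max_{\bm{y}'\in\mathcal{Y}}\left(\bm{\theta}^\top\bm{y}'+\frac m2\|\bm{y}-\bm{y}'\|^2\right)\ \Rightarrow\ L(\bm{\theta};\bm{y})=0.$$ The smallest such $m$ is called the margin of $L$. *)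

theory Defs
  imports "HOL-Analysis.Analysis"
begin

definition indicator_fun :: "'a set \<Rightarrow> 'a \<Rightarrow> ereal" where
  "indicator_fun C y = (if y \<in> C then 0 else \<infinity>)"

definition fenchel_conjugate :: "('a::euclidean_space \<Rightarrow> ereal) \<Rightarrow> 'a \<Rightarrow> ereal" where
  "fenchel_conjugate \<Omega> \<theta> = (SUP y. ereal (\<theta> \<bullet> y) - \<Omega> y)"

definition fenchel_young_loss :: "('a::euclidean_space \<Rightarrow> ereal) \<Rightarrow> 'a \<Rightarrow> 'a \<Rightarrow> ereal" where
  "fenchel_young_loss \<Omega> \<theta> y = \<Omega> y + fenchel_conjugate \<Omega> \<theta> - ereal (\<theta> \<bullet> y)"

definition bit_vectors :: "(real ^ 'n) set" where
  "bit_vectors = {y. \<forall>i. y $ i \<in> {0, 1}}"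

(* The Euclidean norm of the subvector of y with coordinates in V.  The norm on real ^ 'n is
   the case V = UNIV. *)
definition block_norm :: "'n::finite set \<Rightarrow> real ^ 'n \<Rightarrow> real" where
  "block_norm V y = L2_set (\<lambda>i. y $ i) V"

definition sparsemap_reg :: "(real ^ 'n) set \<Rightarrow> real ^ 'n \<Rightarrow> ereal" where
  "sparsemap_reg Y y = ereal (1 / 2 * (norm y)\<^sup>2) + indicator_fun (convex hull Y) y"

definition sparsemap_reg_block ::
    "'n::finite set \<Rightarrow> (real ^ 'n) set \<Rightarrow> real ^ 'n \<Rightarrow> ereal" where
  "sparsemap_reg_block V Y y =
     ereal (1 / 2 * (block_norm V y)\<^sup>2) + indicator_fun (convex hull Y) y"

(* Meaningful only for finite Y, such as sets of bit vectors: Max is unspecified on infinite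
   sets.  Max of the empty set cannot occur, because y ranges over Y. *)
definition structured_margin ::
    "'a::euclidean_space set \<Rightarrow> ('a \<Rightarrow> 'a \<Rightarrow> ereal) \<Rightarrow> real \<Rightarrow> bool" where
  "structured_margin Y L m \<longleftrightarrow>
     0 \<le> m \<and>
     (\<forall>y\<in>Y. \<forall>\<theta>. \<theta> \<bullet> y \<ge> Max ((\<lambda>y'. \<theta> \<bullet> y' + m / 2 * (norm (y - y'))\<^sup>2) ` Y)
        \<longrightarrow> L \<theta> y = 0)"

definition is_margin ::
    "'a::euclidean_space set \<Rightarrow> ('a \<Rightarrow> 'a \<Rightarrow> ereal) \<Rightarrow> real \<Rightarrow> bool" where
  "is_margin Y L m \<longleftrightarrow>
     structured_margin Y L m \<and> (\<forall>m'. structured_margin Y L m' \<longrightarrow> m \<le> m')"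

end

(* By convexity and the constant norm of the A-images, the loss with regularizer
   1/2 |A y|^2 + I_conv(Y) vanishes at (theta, y) iff
   theta . (y - y') >= 1/2 |A y - A y'|^2 for all y' in Y.  For A = id this is the hypothesis of
   the margin condition with m = 1, and theta = m y shows that no m < 1 will do.
   For A the projection onto the V block, |A y - A y'| <= |y - y'|, so m = 1 is still admissible;
   the infimum of the admissible m is attained because replacing theta by theta + e y raises the
   separation theta . (y - y') by e/2 |y - y'|^2. *)
theory Submission
  imports Defs
begin

text \<open>A bit vector is determined by its set of ones. Finiteness turns the \<open>Max\<close>
  of the margin condition into a genuine maximum over \<open>Y\<close>.\<close>

lemma finite_bit_vectors: "finite (bit_vectors :: (real ^ 'n) set)"
proof -
  have "(bit_vectors :: (real ^ 'n) set) \<subseteq> range (\<lambda>S. \<chi> i. if i \<in> S then 1 else 0)"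
  proof
    fix y :: "real ^ 'n"
    assume "y \<in> bit_vectors"
    then have "y = (\<chi> i. if i \<in> {i. y $ i = 1} then 1 else 0)"
      by (auto simp: bit_vectors_def vec_eq_iff)
    then show "y \<in> range (\<lambda>S. \<chi> i. if i \<in> S then 1 else 0)"
      by blast
  qed
  then show ?thesis
    by (rule finite_subset) simp
qed

text \<open>Let \<open>t\<close> tend to 0 from the right. The bound \<open>t \<le> 1\<close> lets
  \<open>t\<close> serve as a convex weight.\<close>

lemma le_if_le_add_small_multiple:
  fixes a b k :: real
  assumes "\<And>t. 0 < t \<Longrightarrow> t \<le> 1 \<Longrightarrow> b \<le> a + t * k"
  shows "b \<le> a"
proof -
  have "((\<lambda>t. a + t * k) \<longlongrightarrow> a + 0 * k) (at_right 0)"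
    by (intro tendsto_intros)
  moreover have "eventually (\<lambda>t. b \<le> a + t * k) (at_right 0)"
    unfolding eventually_at_right_field by (rule exI[of _ 1]) (use assms in auto)
  ultimately show ?thesis
    using tendsto_lowerbound[of "\<lambda>t. a + t * k" "a + 0 * k" "at_right 0" b] by simp
qed

text \<open>On a sphere the squared distance to \<open>u\<close> is affine in \<open>v\<close>,
  since the two square terms are constant. The sphere hypotheses enter the argument through this
  identity.\<close>

lemma inner_diff_same_norm:
  fixes u v :: "'a::real_inner"
  assumes "norm u = norm v"
  shows "u \<bullet> (u - v) = 1 / 2 * (norm (u - v))\<^sup>2"
proof -
  have "u \<bullet> u = v \<bullet> v"
    using assms by (simp add: dot_square_norm)
  then show ?thesis
    by (simp add: power2_norm_eq_inner inner_diff inner_commute)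
qed

text \<open>Taking \<open>y\<close> itself in the supremum shows that the loss is never negative
  (the Fenchel-Young inequality), so it vanishes iff \<open>y\<close> attains the supremum.
  Finiteness of the value at \<open>y\<close> keeps the extended-real arithmetic harmless.\<close>

lemma fenchel_young_loss_eq_0_iff:
  assumes "\<Omega> y = ereal c"
  shows "fenchel_young_loss \<Omega> \<theta> y = 0 \<longleftrightarrow>
         (\<forall>z. ereal (\<theta> \<bullet> z) - \<Omega> z \<le> ereal (\<theta> \<bullet> y - c))"
proof -
  have "ereal (\<theta> \<bullet> y - c) \<le> fenchel_conjugate \<Omega> \<theta>"
    unfolding fenchel_conjugate_def by (rule SUP_upper2[of y]) (simp_all add: assms)
  moreover have "fenchel_young_loss \<Omega> \<theta> y = 0 \<longleftrightarrow>
      fenchel_conjugate \<Omega> \<theta> = ereal (\<theta> \<bullet> y - c)"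
    unfolding fenchel_young_loss_def assms
    by (cases "fenchel_conjugate \<Omega> \<theta>") (auto simp: zero_ereal_def)
  ultimately have "fenchel_young_loss \<Omega> \<theta> y = 0 \<longleftrightarrow>
      fenchel_conjugate \<Omega> \<theta> \<le> ereal (\<theta> \<bullet> y - c)"
    by auto
  then show ?thesis
    unfolding fenchel_conjugate_def by (simp add: SUP_le_iff)
qed

lemma structured_margin_iff:
  assumes "finite Y"
  shows "structured_margin Y L m \<longleftrightarrow>
         0 \<le> m \<and>
         (\<forall>y\<in>Y. \<forall>\<theta>. (\<forall>y'\<in>Y. m / 2 * (norm (y - y'))\<^sup>2 \<le> \<theta> \<bullet> (y - y')) \<longrightarrow> L \<theta> y = 0)"
proof -
  have "Max ((\<lambda>y'. \<theta> \<bullet> y' + m / 2 * (norm (y - y'))\<^sup>2) ` Y) \<le> \<theta> \<bullet> y \<longleftrightarrow>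
        (\<forall>y'\<in>Y. m / 2 * (norm (y - y'))\<^sup>2 \<le> \<theta> \<bullet> (y - y'))" if "y \<in> Y" for y \<theta>
  proof -
    have "Max ((\<lambda>y'. \<theta> \<bullet> y' + m / 2 * (norm (y - y'))\<^sup>2) ` Y) \<le> \<theta> \<bullet> y \<longleftrightarrow>
          (\<forall>y'\<in>Y. \<theta> \<bullet> y' + m / 2 * (norm (y - y'))\<^sup>2 \<le> \<theta> \<bullet> y)"
      using assms that by (subst Max_le_iff) auto
    then show ?thesis
      by (simp add: inner_diff_right le_diff_eq add.commute)
  qed
  then show ?thesis
    unfolding structured_margin_def by (simp cong: ball_cong)
qed

text \<open>Common form of both regularizers: \<open>A\<close> is the identity in the first case and
  the projection onto the \<open>V\<close> block in the second.\<close>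

definition quadratic_reg ::
    "('a::euclidean_space \<Rightarrow> 'b::real_inner) \<Rightarrow> 'a set \<Rightarrow> 'a \<Rightarrow> ereal" where
  "quadratic_reg A Y y = ereal (1 / 2 * (norm (A y))\<^sup>2) + indicator_fun (convex hull Y) y"

text \<open>Points outside the hull contribute minus infinity to the conjugate and impose no
  constraint.\<close>

lemma loss_quadratic_reg_eq_0_iff_hull:
  assumes "y \<in> Y"
  shows "fenchel_young_loss (quadratic_reg A Y) \<theta> y = 0 \<longleftrightarrow>
         (\<forall>z\<in>convex hull Y.
            \<theta> \<bullet> z - 1 / 2 * (norm (A z))\<^sup>2 \<le> \<theta> \<bullet> y - 1 / 2 * (norm (A y))\<^sup>2)"
proof -
  have "quadratic_reg A Y y = ereal (1 / 2 * (norm (A y))\<^sup>2)"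
    using hull_inc[OF assms] by (simp add: quadratic_reg_def indicator_fun_def)
  from fenchel_young_loss_eq_0_iff[of "quadratic_reg A Y", OF this] show ?thesis
    by (auto simp: quadratic_reg_def indicator_fun_def)
qed

text \<open>First-order optimality: \<open>y\<close> maximizes a concave function over the hull iff
  no directional derivative towards a point \<open>y'\<close> of \<open>Y\<close> is positive, that
  is \<open>A y \<bullet> (A y - A y') \<le> \<theta> \<bullet> (y - y')\<close>. Constancy of
  \<open>norm (A y)\<close> on \<open>Y\<close> turns the left side into half a squared
  distance.\<close>

lemma loss_quadratic_reg_eq_0_iff:
  fixes A :: "'a::euclidean_space \<Rightarrow> 'b::real_inner"
  assumes A: "linear A"
    and \<rho>: "\<And>y. y \<in> Y \<Longrightarrow> norm (A y) = \<rho>"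
    and y: "y \<in> Y"
  shows "fenchel_young_loss (quadratic_reg A Y) \<theta> y = 0 \<longleftrightarrow>
         (\<forall>y'\<in>Y. 1 / 2 * (norm (A y - A y'))\<^sup>2 \<le> \<theta> \<bullet> (y - y'))"
    (is "?loss \<longleftrightarrow> ?sep")
proof
  assume ?loss
  show ?sep
  proof
    fix y'
    assume y': "y' \<in> Y"
    define d where "d = (norm (A y - A y'))\<^sup>2"
    have "1 / 2 * d \<le> \<theta> \<bullet> (y - y') + t * (1 / 2 * d)" if t: "0 < t" "t \<le> 1" for t
    proof -
      \<comment> \<open>Move from \<open>y\<close> a fraction \<open>t\<close> of the way to
        \<open>y'\<close>. Optimality of \<open>y\<close> against \<open>z\<close>, divided by
        \<open>t\<close>, gives the claim up to an error of order \<open>t\<close>.\<close>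
      define z where "z = (1 - t) *\<^sub>R y + t *\<^sub>R y'"
      have "z \<in> convex hull Y"
        unfolding z_def using t y y' by (intro convexD_alt convex_convex_hull hull_inc) auto
      then have le: "\<theta> \<bullet> z - 1 / 2 * (norm (A z))\<^sup>2 \<le> \<theta> \<bullet> y - 1 / 2 * (norm (A y))\<^sup>2"
        using \<open>?loss\<close> loss_quadratic_reg_eq_0_iff_hull[OF y] by blast
      have Az: "A z = A y - t *\<^sub>R (A y - A y')"
        by (simp add: z_def linear_add[OF A] linear_diff[OF A] linear_scale[OF A] algebra_simps)
      have "(norm (A z))\<^sup>2 = (norm (A y))\<^sup>2 - 2 * t * (A y \<bullet> (A y - A y')) + t\<^sup>2 * d"
        unfolding Az d_def power2_norm_eq_inner power2_eq_square[of t]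
        by (simp only: inner_diff inner_scaleR_left inner_scaleR_right inner_commute algebra_simps)
      also have "A y \<bullet> (A y - A y') = 1 / 2 * d"
        unfolding d_def using \<rho> y y' by (intro inner_diff_same_norm) simp
      finally have "t * (1 / 2 * d) \<le> t * (\<theta> \<bullet> (y - y') + t * (1 / 2 * d))"
        using le by (simp add: z_def inner_diff inner_add algebra_simps power2_eq_square)
      then show ?thesis
        using t by simp
    qed
    then show "1 / 2 * (norm (A y - A y'))\<^sup>2 \<le> \<theta> \<bullet> (y - y')"
      unfolding d_def by (rule le_if_le_add_small_multiple)
  qed
next
  assume ?sep
  \<comment> \<open>The first-order condition is affine in \<open>z\<close>: it cuts out a
    half-space or a trivial set, which is convex, so it passes from \<open>Y\<close> to the
    hull.\<close>
  have lin: "A y \<bullet> (A y - A z) \<le> \<theta> \<bullet> (y - z)" if "z \<in> convex hull Y" for z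
  proof -
    define S where "S = {z. A y \<bullet> (A y - A z) \<le> \<theta> \<bullet> (y - z)}"
    have "Y \<subseteq> S"
    proof
      fix y'
      assume y': "y' \<in> Y"
      then have "A y \<bullet> (A y - A y') = 1 / 2 * (norm (A y - A y'))\<^sup>2"
        using \<rho> y by (intro inner_diff_same_norm) simp
      with \<open>?sep\<close> y' show "y' \<in> S"
        unfolding S_def mem_Collect_eq by metis
    qed
    moreover have "convex S"
    proof -
      have "linear (\<lambda>z. \<theta> \<bullet> z - A y \<bullet> A z)"
        by (rule linearI)
          (simp_all add: linear_add[OF A] linear_scale[OF A] inner_add algebra_simps)
      then have "convex ((\<lambda>z. \<theta> \<bullet> z - A y \<bullet> A z) -` {..\<theta> \<bullet> y - A y \<bullet> A y})"
        by (rule convex_linear_vimage) simp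
      also have "(\<lambda>z. \<theta> \<bullet> z - A y \<bullet> A z) -` {..\<theta> \<bullet> y - A y \<bullet> A y} = S"
        by (auto simp: S_def inner_diff_right)
      finally show ?thesis .
    qed
    ultimately have "convex hull Y \<subseteq> S"
      by (rule hull_minimal)
    with that show ?thesis
      by (auto simp: S_def)
  qed
  have "\<theta> \<bullet> z - 1 / 2 * (norm (A z))\<^sup>2 \<le> \<theta> \<bullet> y - 1 / 2 * (norm (A y))\<^sup>2"
    if "z \<in> convex hull Y" for z
  proof -
    \<comment> \<open>Passing from the linear bound to the quadratic one loses exactly half of this
      square.\<close>
    have "0 \<le> (norm (A y - A z))\<^sup>2"
      by simp
    with lin[OF that] show ?thesis
      by (simp add: power2_norm_eq_inner inner_diff inner_commute)
  qed
  then show ?loss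
    using loss_quadratic_reg_eq_0_iff_hull[OF y] by blast
qed

text \<open>Since \<open>A\<close> is linear and does not increase norms, separation by half the
  squared distance of the points implies separation by half that of their images, which makes the
  loss vanish.\<close>

lemma structured_margin_quadratic_reg_1:
  fixes A :: "'a::euclidean_space \<Rightarrow> 'b::real_inner"
  assumes "finite Y" "linear A"
    and "\<And>y. y \<in> Y \<Longrightarrow> norm (A y) = \<rho>"
    and contr: "\<And>x. norm (A x) \<le> norm x"
  shows "structured_margin Y (fenchel_young_loss (quadratic_reg A Y)) 1"
  unfolding structured_margin_iff[OF \<open>finite Y\<close>]
proof (intro conjI ballI allI impI)
  fix y \<theta>
  assume y: "y \<in> Y" and sep: "\<forall>y'\<in>Y. 1 / 2 * (norm (y - y'))\<^sup>2 \<le> \<theta> \<bullet> (y - y')"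
  have "1 / 2 * (norm (A y - A y'))\<^sup>2 \<le> \<theta> \<bullet> (y - y')" if "y' \<in> Y" for y'
  proof -
    have "(norm (A y - A y'))\<^sup>2 \<le> (norm (y - y'))\<^sup>2"
      using contr[of "y - y'"] by (simp add: linear_diff[OF \<open>linear A\<close>] power_mono)
    moreover have "1 / 2 * (norm (y - y'))\<^sup>2 \<le> \<theta> \<bullet> (y - y')"
      using sep that by blast
    ultimately show ?thesis
      by linarith
  qed
  then show "fenchel_young_loss (quadratic_reg A Y) \<theta> y = 0"
    using loss_quadratic_reg_eq_0_iff[OF assms(2,3) y] by blast
qed simp

text \<open>The separation hypothesis weakens as \<open>m\<close> decreases, so the infimum does not
  inherit admissibility directly. It is obtained by perturbing \<open>\<theta>\<close> in the
  direction \<open>y\<close> and letting the perturbation tend to 0; \<open>m\<^sub>1\<close> only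
  ensures that admissible values exist.\<close>

lemma is_margin_quadratic_reg_Inf:
  fixes A :: "'a::euclidean_space \<Rightarrow> 'b::real_inner"
  assumes "finite Y" "linear A"
    and "\<And>y. y \<in> Y \<Longrightarrow> norm (A y) = \<rho>"
    and r: "\<And>y. y \<in> Y \<Longrightarrow> norm y = r"
    and ex: "structured_margin Y (fenchel_young_loss (quadratic_reg A Y)) m\<^sub>1"
  shows "is_margin Y (fenchel_young_loss (quadratic_reg A Y))
           (Inf {m. structured_margin Y (fenchel_young_loss (quadratic_reg A Y)) m})"
proof -
  define L where "L = fenchel_young_loss (quadratic_reg A Y)"
  define S where "S = {m. structured_margin Y L m}"
  have "S \<noteq> {}"
    using ex by (auto simp: S_def L_def)
  have "0 \<le> m" if "m \<in> S" for m
    using that by (simp add: S_def structured_margin_def)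
  then have "bdd_below S" and "0 \<le> Inf S"
    using \<open>S \<noteq> {}\<close> by (meson bdd_belowI, meson cInf_greatest)
  have "L \<theta> y = 0"
    if y: "y \<in> Y" and sep: "\<forall>y'\<in>Y. Inf S / 2 * (norm (y - y'))\<^sup>2 \<le> \<theta> \<bullet> (y - y')" for y \<theta>
  proof -
    have "1 / 2 * (norm (A y - A y'))\<^sup>2 \<le> \<theta> \<bullet> (y - y')" if y': "y' \<in> Y" for y'
    proof (rule le_if_le_add_small_multiple)
      fix t :: real
      assume "0 < t"
      then obtain m where "m \<in> S" "m < Inf S + t"
        using cInf_lessD[OF \<open>S \<noteq> {}\<close>, of "Inf S + t"] by auto
      have "m / 2 * (norm (y - x))\<^sup>2 \<le> (\<theta> + t *\<^sub>R y) \<bullet> (y - x)" if x: "x \<in> Y" for x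
      proof -
        have "m / 2 * (norm (y - x))\<^sup>2 \<le> (Inf S + t) / 2 * (norm (y - x))\<^sup>2"
          using \<open>m < Inf S + t\<close> by (intro mult_right_mono) simp_all
        \<comment> \<open>By the sphere identity, adding \<open>t *\<^sub>R y\<close> to
          \<open>\<theta>\<close> contributes exactly the \<open>t\<close> by which \<open>m\<close>
          may exceed the infimum.\<close>
        also have "\<dots> = Inf S / 2 * (norm (y - x))\<^sup>2 + t * (y \<bullet> (y - x))"
          using inner_diff_same_norm[of y x] r x y by (simp add: field_simps)
        also have "\<dots> \<le> \<theta> \<bullet> (y - x) + t * (y \<bullet> (y - x))"
          using sep x by simp
        finally show ?thesis
          by (simp add: inner_add_left)
      qed
      then have "L (\<theta> + t *\<^sub>R y) y = 0"
        using \<open>m \<in> S\<close> y by (simp add: S_def structured_margin_iff[OF \<open>finite Y\<close>])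
      then have "1 / 2 * (norm (A y - A y'))\<^sup>2 \<le> (\<theta> + t *\<^sub>R y) \<bullet> (y - y')"
        using loss_quadratic_reg_eq_0_iff[OF assms(2,3) y] y' unfolding L_def by blast
      then show "1 / 2 * (norm (A y - A y'))\<^sup>2 \<le> \<theta> \<bullet> (y - y') + t * (y \<bullet> (y - y'))"
        by (simp add: inner_add_left)
    qed
    then show ?thesis
      using loss_quadratic_reg_eq_0_iff[OF assms(2,3) y] unfolding L_def by blast
  qed
  then have "structured_margin Y L (Inf S)"
    using \<open>0 \<le> Inf S\<close> by (simp add: structured_margin_iff[OF \<open>finite Y\<close>])
  then show ?thesis
    using cInf_lower[OF _ \<open>bdd_below S\<close>] unfolding is_margin_def S_def L_def by blast
qed

text \<open>For \<open>\<theta> = m *\<^sub>R y\<close> the margin condition holds with equality at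
  every point of \<open>Y\<close>. Zero loss then compares the factors 1 and \<open>m\<close> of the
  same squared distance, which is positive for distinct points.\<close>

lemma margin_identity_ge_1:
  assumes "finite Y"
    and r: "\<And>y. y \<in> Y \<Longrightarrow> norm y = r"
    and "y \<in> Y" "y' \<in> Y" "y \<noteq> y'"
    and m: "structured_margin Y (fenchel_young_loss (quadratic_reg (\<lambda>x. x) Y)) m"
  shows "1 \<le> m"
proof -
  have eq: "(m *\<^sub>R y) \<bullet> (y - x) = m / 2 * (norm (y - x))\<^sup>2" if "x \<in> Y" for x
    using inner_diff_same_norm[of y x] r that \<open>y \<in> Y\<close> by simp
  then have "fenchel_young_loss (quadratic_reg (\<lambda>x. x) Y) (m *\<^sub>R y) y = 0"
    using m \<open>y \<in> Y\<close> unfolding structured_margin_iff[OF \<open>finite Y\<close>] by (metis order_refl)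
  then have "1 / 2 * (norm (y - y'))\<^sup>2 \<le> m / 2 * (norm (y - y'))\<^sup>2"
    using loss_quadratic_reg_eq_0_iff[OF linear_id[unfolded id_def] r \<open>y \<in> Y\<close>]
      eq[OF \<open>y' \<in> Y\<close>] \<open>y' \<in> Y\<close> by metis
  then show ?thesis
    using \<open>y \<noteq> y'\<close> by simp
qed

text \<open>Coordinates outside \<open>V\<close> are set to zero rather than dropped, which keeps
  the projection an endomorphism of one fixed space.\<close>

definition block_proj :: "'n::finite set \<Rightarrow> real ^ 'n \<Rightarrow> real ^ 'n" where
  "block_proj V y = (\<chi> i. if i \<in> V then y $ i else 0)"

lemma linear_block_proj: "linear (block_proj V)"
  by (rule linearI) (auto simp: block_proj_def vec_eq_iff)

lemma norm_block_proj: "norm (block_proj V y) = block_norm V y"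
proof -
  have "(\<Sum>i\<in>UNIV. (if i \<in> V then y $ i else 0)\<^sup>2) = (\<Sum>i\<in>V. (y $ i)\<^sup>2)"
    by (rule sum.mono_neutral_cong_right) auto
  then show ?thesis
    by (simp add: block_proj_def block_norm_def norm_vec_def L2_set_def)
qed

lemma norm_block_proj_le: "norm (block_proj V y) \<le> norm y"
  by (rule norm_le_componentwise_cart) (simp add: block_proj_def)

lemma sparsemap_reg_eq: "sparsemap_reg Y = quadratic_reg (\<lambda>x. x) Y"
  by (simp add: fun_eq_iff sparsemap_reg_def quadratic_reg_def)

lemma sparsemap_reg_block_eq: "sparsemap_reg_block V Y = quadratic_reg (block_proj V) Y"
  by (simp add: fun_eq_iff sparsemap_reg_block_def quadratic_reg_def norm_block_proj)

theorem proposition4: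
  fixes Y :: "(real ^ 'n) set" and r :: real
  assumes "Y \<subseteq> bit_vectors"
    and "r > 0"
    and "\<forall>y\<in>Y. norm y = r"
  shows "(structured_margin Y (fenchel_young_loss (sparsemap_reg Y)) 1 \<and>
          ((\<exists>y\<in>Y. \<exists>y'\<in>Y. y \<noteq> y') \<longrightarrow>
             is_margin Y (fenchel_young_loss (sparsemap_reg Y)) 1)) \<and>
         (\<forall>(V :: 'n set) (F :: 'n set) (r\<^sub>V :: real) (r\<^sub>F :: real).
            V \<union> F = UNIV \<longrightarrow> V \<inter> F = {} \<longrightarrow>
            r\<^sub>V\<^sup>2 + r\<^sub>F\<^sup>2 = r\<^sup>2 \<longrightarrow>
            (\<forall>y\<in>Y. block_norm V y = r\<^sub>V \<and> block_norm F y = r\<^sub>F) \<longrightarrow>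
            (\<exists>m\<le>1. is_margin Y (fenchel_young_loss (sparsemap_reg_block V Y)) m))"
proof (intro conjI impI allI)
  have "finite Y"
    using assms(1) finite_bit_vectors by (rule finite_subset)
  have r: "norm y = r" if "y \<in> Y" for y
    using assms(3) that by blast
  show margin_1: "structured_margin Y (fenchel_young_loss (sparsemap_reg Y)) 1"
    unfolding sparsemap_reg_eq
    by (rule structured_margin_quadratic_reg_1[OF \<open>finite Y\<close> linear_id[unfolded id_def] r]) simp_all
  \<comment> \<open>With at most one point in \<open>Y\<close>, already \<open>m = 0\<close> is
    admissible; two distinct points force \<open>m\<close> to be at least 1.\<close>
  show "is_margin Y (fenchel_young_loss (sparsemap_reg Y)) 1" if "\<exists>y\<in>Y. \<exists>y'\<in>Y. y \<noteq> y'"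
    using that margin_1 margin_identity_ge_1[OF \<open>finite Y\<close> r]
    unfolding is_margin_def sparsemap_reg_eq by blast
  fix V F :: "'n set" and r\<^sub>V r\<^sub>F :: real
  assume "\<forall>y\<in>Y. block_norm V y = r\<^sub>V \<and> block_norm F y = r\<^sub>F"
  then have rV: "norm (block_proj V y) = r\<^sub>V" if "y \<in> Y" for y
    using that by (simp add: norm_block_proj)
  let ?L = "fenchel_young_loss (sparsemap_reg_block V Y)"
  have 1: "structured_margin Y ?L 1"
    unfolding sparsemap_reg_block_eq
    by (rule structured_margin_quadratic_reg_1[OF \<open>finite Y\<close> linear_block_proj rV])
      (simp_all add: norm_block_proj_le)
  \<comment> \<open>Admissibility of 1 supplies the nonemptiness needed for the infimum, and
    minimality of the infimum then bounds it by 1.\<close>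
  then have "is_margin Y ?L (Inf {m. structured_margin Y ?L m})"
    unfolding sparsemap_reg_block_eq
    by (intro is_margin_quadratic_reg_Inf[OF \<open>finite Y\<close> linear_block_proj rV r])
  with 1 show "\<exists>m\<le>1. is_margin Y ?L m"
    unfolding is_margin_def by blast
qed

end
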